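(* Let $N\ge1$ be an integer and $V\in C_0$. Then $$\mathcal I_N(V)=\frac{k_N(V)}{N}.$$ As a consequence, the map $V\in C_0\mapsto\mathcal I_N(V)$ takes values in the finite set $\{\frac kN : 0\le k\le N\}$.
   Context: Let $d\ge1$ be an integer. $\mathcal P$ is the set of Borel probability measures on $\mathbb R^d$; $\mathcal P^-$ is the set of nonnegative Borel measures $\rho$ on $\mathbb R^d$ with total mass $\|\rho\|=\rho(\mathbb R^d)\le 1$. $C_0$ is the space of real continuous functions on $\mathbb R^d$ vanishing at infinity and $\stackrel{*}{\rightharpoonup}$ is weak* convergence in duality with $C_0$. For $k\ge1$, $c_k(x_1,\dots,x_k)=\sum_{1\le i<j\le k}\frac1{|x_i-x_j|}$ for $x_i\in\mathbb R^d$ (with $1/0=+\infty$, $c_1=0$). For $\rho\in\mathcal P$, $C(\rho)=\inf\{\int c_N\,dP : P \text{ Borel probability on }(\mathbb R^d)^N \text{ with all } N \text{ marginals equal to } \rho\}$; for $\rho\in\mathcal P^-$, $\overline C(\rho)=\inf\{\liminf_n C(\rho_n) : \rho_n\in\mathcal P,\ \rho_n\stackrel{*}{\rightharpoonup}\rho\}$. For $V\in C_0$, $\mathcal S_V$ is the set of $\rho\in\mathcal P^-$ minimizing $\overline C(\rho)-\int V\,d\rho$ over $\mathcal P^-$ (a nonempty convex weakly* compact set), and $\mathcal I_N(V)=\min\{\|\rho\| : \rho\in\mathcal S_V\}$. For $\varphi\in C_0$ and $k\ge1$, $M_k(\varphi)=\sup\{\frac1k\sum_{i=1}^k\varphi(x_i)-c_k(x_1,\dots,x_k)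 : x_1,\dots,x_k\in\mathbb R^d\}$, and by convention $M_0(0)=0$. If the positive part $V^+=\max\{V,0\}$ does not vanish identically, $$k_N(V)=\max\left\{k\in\{1,\dots,N\} : M_k\Big(\frac kN V\Big)>M_{k-1}\Big(\frac{k-1}N V\Big)\right\};$$ if $V^+\equiv0$, $k_N(V)=0$. *)

theory Defs
  imports "HOL-Probability.Probability"
begin

definition C0 :: "(real ^ 'd \<Rightarrow> real) set" where
  "C0 = {\<phi>. continuous_on UNIV \<phi> \<and> (\<phi> \<longlongrightarrow> 0) at_infinity}"

definition prob_measures :: "(real ^ 'd) measure set" where
  "prob_measures = {\<rho>. sets \<rho> = sets borel \<and> prob_space \<rho>}"

definition subprob_measures :: "(real ^ 'd) measure set" where
  "subprob_measures = {\<rho>. sets \<rho> = sets borel \<and> emeasure \<rho> UNIV \<le> 1}"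

definition weak_star_conv ::
    "(nat \<Rightarrow> (real ^ 'd) measure) \<Rightarrow> (real ^ 'd) measure \<Rightarrow> bool" where
  "weak_star_conv \<rho>s \<rho> \<longleftrightarrow>
     (\<forall>\<phi>\<in>C0. (\<lambda>n. integral\<^sup>L (\<rho>s n) \<phi>) \<longlonglongrightarrow> integral\<^sup>L \<rho> \<phi>)"

text \<open>
  The \<open>k\<close> points are \<open>x 0, \<dots>, x (k - 1)\<close>; the remaining values of \<open>x\<close> are irrelevant.
  In \<^typ>\<open>ennreal\<close>, \<open>1 / 0 = \<infinity>\<close>, as required for coinciding points.
\<close>
definition coulomb_cost :: "nat \<Rightarrow> (nat \<Rightarrow> real ^ 'd) \<Rightarrow> ennreal" where
  "coulomb_cost k x = (\<Sum>j<k. \<Sum>i<j. 1 / ennreal (norm (x i - x j)))"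

text \<open>
  A point of the \<open>N\<close>-fold power of the space is an extensional function on \<open>{..<N}\<close>. The product
  of finitely many copies of the Borel \<open>\<sigma>\<close>-algebra is the Borel \<open>\<sigma>\<close>-algebra of the product,
  the factors being second countable.
\<close>
definition transport_plans ::
    "nat \<Rightarrow> (real ^ 'd) measure \<Rightarrow> (nat \<Rightarrow> real ^ 'd) measure set" where
  "transport_plans N \<rho> =
     {P. sets P = sets (\<Pi>\<^sub>M i\<in>{..<N}. borel) \<and> prob_space P \<and>
         (\<forall>i<N. distr P borel (\<lambda>x. x i) = \<rho>)}"

definition mot_cost :: "nat \<Rightarrow> (real ^ 'd) measure \<Rightarrow> ennreal" where
  "mot_cost N \<rho> = (INF P\<in>transport_plans N \<rho>. \<integral>\<^sup>+ x. coulomb_cost N x \<partial>P)"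

definition relaxed_cost :: "nat \<Rightarrow> (real ^ 'd) measure \<Rightarrow> ennreal" where
  "relaxed_cost N \<rho> =
     Inf {liminf (\<lambda>n. mot_cost N (\<rho>s n)) | \<rho>s.
            (\<forall>n. \<rho>s n \<in> prob_measures) \<and> weak_star_conv \<rho>s \<rho>}"

definition energy :: "nat \<Rightarrow> (real ^ 'd \<Rightarrow> real) \<Rightarrow> (real ^ 'd) measure \<Rightarrow> ereal" where
  "energy N V \<rho> = enn2ereal (relaxed_cost N \<rho>) - ereal (integral\<^sup>L \<rho> V)"

definition minimizers :: "nat \<Rightarrow> (real ^ 'd \<Rightarrow> real) \<Rightarrow> (real ^ 'd) measure set" where
  "minimizers N V =
     {\<rho> \<in> subprob_measures. \<forall>\<rho>'\<in>subprob_measures. energy N V \<rho> \<le> energy N V \<rho>'}"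

text \<open>A genuine minimum, not merely an infimum: \<open>LEAST\<close> is only specified if it is attained.\<close>
definition ionization :: "nat \<Rightarrow> (real ^ 'd \<Rightarrow> real) \<Rightarrow> real" where
  "ionization N V = (LEAST m. m \<in> (\<lambda>\<rho>. measure \<rho> UNIV) ` minimizers N V)"

text \<open>The \<open>0\<close>-th functional is only ever evaluated at \<open>\<phi> = 0\<close>.\<close>
definition sup_functional :: "nat \<Rightarrow> (real ^ 'd \<Rightarrow> real) \<Rightarrow> ereal" where
  "sup_functional k \<phi> =
     (if k = 0 then 0
      else SUP x. ereal (1 / real k * (\<Sum>i<k. \<phi> (x i))) - enn2ereal (coulomb_cost k x))"

definition critical_index :: "nat \<Rightarrow> (real ^ 'd \<Rightarrow> real) \<Rightarrow> nat" where
  "critical_index N V =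
     (if \<forall>x. max (V x) 0 = 0 then 0
      else Max {k \<in> {1..N}.
             sup_functional k (\<lambda>x. real k / real N * V x)
               > sup_functional (k - 1) (\<lambda>x. real (k - 1) / real N * V x)})"

end

(* For potentials phi = V/N, let G k be the supremum of sum_{i<k} phi(x_i) - c_k(x) over k-point
   configurations. Moving a particle to infinity shows that G is nondecreasing, so k_N(V) is the
   least k with G k = G N.
   A pointwise bound a + sum phi(x_i) <= c_N(x) integrates to a + N int phi drho <= C(rho); being
   weakly* continuous in rho, it passes to the relaxed cost. Hence the energy is at least -G N.
   Since G (k-1) < G k, a maximizing sequence of k-point configurations cannot lose particles, so a
   maximizer x exists, and (1/N) sum_{i<k} delta_{x_i}, the weak* limit of configurations whose
   other N - k particles escape, is a minimizer of mass k/N.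
   Conversely, configurations with fewer than k particles in a large ball miss G N by a fixed gap, so
   the pointwise bound persists for V minus a small multiple of a cutoff function of the ball; this
   forces every minimizer to have mass at least k/N. *)

theory Submission
  imports Defs
begin

section \<open>Functions vanishing at infinity\<close>

lemma C0_continuous: "\<phi> \<in> C0 \<Longrightarrow> continuous_on UNIV \<phi>"
  by (simp add: C0_def)

lemma C0_small_outside_ball:
  fixes \<phi> :: "real ^ 'd \<Rightarrow> real"
  assumes "\<phi> \<in> C0" and "0 < \<epsilon>"
  obtains R where "\<And>x. R < norm x \<Longrightarrow> \<bar>\<phi> x\<bar> < \<epsilon>"
proof -
  have "\<forall>\<^sub>F x in at_infinity. dist (\<phi> x) 0 < \<epsilon>"
    using assms by (intro tendstoD) (auto simp: C0_def)
  then obtain R where "\<And>x. R \<le> norm x \<Longrightarrow> \<bar>\<phi> x\<bar> < \<epsilon>"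
    by (auto simp: eventually_at_infinity)
  then show ?thesis
    by (intro that[of R]) auto
qed

lemma C0_bounded:
  fixes \<phi> :: "real ^ 'd \<Rightarrow> real"
  assumes "\<phi> \<in> C0"
  obtains B where "\<And>x. \<bar>\<phi> x\<bar> \<le> B"
proof -
  obtain R where R: "\<And>x. R < norm x \<Longrightarrow> \<bar>\<phi> x\<bar> < 1"
    using C0_small_outside_ball[OF assms zero_less_one] by blast
  have "compact (\<phi> ` cball 0 R)"
    by (intro compact_continuous_image continuous_on_subset[OF C0_continuous[OF assms]]) auto
  then obtain B where B: "\<And>y. y \<in> \<phi> ` cball 0 R \<Longrightarrow> \<bar>y\<bar> \<le> B"
    by (metis compact_imp_bounded bounded_real)
  have "\<bar>\<phi> x\<bar> \<le> max B 1" for x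
    using R[of x] B[of "\<phi> x"] by (cases "norm x \<le> R") force+
  then show ?thesis
    by (rule that)
qed

lemma C0_tendsto_zero:
  assumes "\<phi> \<in> C0" and "filterlim f at_infinity F"
  shows "((\<lambda>n. \<phi> (f n)) \<longlongrightarrow> 0) F"
  using assms by (auto simp: C0_def intro: filterlim_compose)

lemma C0_diff_scale:
  fixes \<phi> \<psi> :: "real ^ 'd \<Rightarrow> real"
  assumes "\<phi> \<in> C0" and "\<psi> \<in> C0"
  shows "(\<lambda>x. a * \<phi> x - b * \<psi> x) \<in> C0"
proof -
  have "((\<lambda>x. a * \<phi> x - b * \<psi> x) \<longlongrightarrow> a * 0 - b * 0) at_infinity"
    using assms by (intro tendsto_intros) (auto simp: C0_def)
  then show ?thesis
    using assms by (auto simp: C0_def intro!: continuous_intros)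
qed

lemma C0_divide: "\<phi> \<in> C0 \<Longrightarrow> (\<lambda>x. \<phi> x / c) \<in> C0"
  using C0_diff_scale[of \<phi> \<phi> "1 / c" 0] by simp

text \<open>Equal to 1 on the ball of radius \<open>R\<close> and to 0 beyond \<open>R + 1\<close>:
  a test function in \<open>C0\<close> that bounds the mass near the origin from below.\<close>

lemma C0_cutoff: "(\<lambda>x :: real ^ 'd. max 0 (min 1 (R + 1 - norm x))) \<in> C0"
proof -
  have "\<forall>\<^sub>F x :: real ^ 'd in at_infinity. max 0 (min 1 (R + 1 - norm x)) = 0"
    unfolding eventually_at_infinity by (intro exI[of _ "R + 1"]) auto
  then have "((\<lambda>x :: real ^ 'd. max 0 (min 1 (R + 1 - norm x))) \<longlongrightarrow> 0) at_infinity"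
    by (rule tendsto_eventually)
  then show ?thesis
    by (auto simp: C0_def intro!: continuous_intros)
qed

text \<open>The inner map \<open>f\<close> lets the same fact serve the coordinates of a transport
  plan and the identity on a single measure.\<close>

lemma C0_integrable:
  fixes \<phi> :: "real ^ 'd \<Rightarrow> real"
  assumes "\<phi> \<in> C0" and "finite_measure M" and "f \<in> borel_measurable M"
  shows "integrable M (\<lambda>x. \<phi> (f x))"
proof -
  obtain B where "\<And>x. \<bar>\<phi> x\<bar> \<le> B"
    using C0_bounded[OF assms(1)] by blast
  then show ?thesis
    using assms
    by (intro finite_measure.integrable_const_bound[where B = B]
          measurable_compose[OF assms(3)] borel_measurable_continuous_onI C0_continuous) auto
qed

section \<open>Symmetry of the Coulomb cost\<close>

text \<open>The sum over ordered pairs counts every interaction twice, but is visibly invariant under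
  reindexing.\<close>

definition interaction :: "'i set \<Rightarrow> ('i \<Rightarrow> real ^ 'd) \<Rightarrow> ennreal" where
  "interaction I x = (\<Sum>i\<in>I. \<Sum>j\<in>I - {i}. 1 / ennreal (norm (x i - x j)))"

text \<open>By induction: the new particle \<open>k\<close> meets every old one once in the row of
  the old index and once in its own row, and symmetry of the norm merges the two.\<close>

lemma interaction_lessThan: "interaction {..<k} x = 2 * coulomb_cost k x"
proof (induction k)
  case 0
  then show ?case by (simp add: interaction_def coulomb_cost_def)
next
  case (Suc k)
  let ?w = "\<lambda>i j. 1 / ennreal (norm (x i - x j))"
  have *: "(\<Sum>j\<in>{..<Suc k} - {i}. ?w i j) = ?w i k + (\<Sum>j\<in>{..<k} - {i}. ?w i j)" if "i < k" for i
  proof -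
    have "{..<Suc k} - {i} = insert k ({..<k} - {i})"
      using that by auto
    then show ?thesis by simp
  qed
  have "{..<Suc k} - {k} = {..<k}" by auto
  then have "interaction {..<Suc k} x =
      (\<Sum>i<k. \<Sum>j\<in>{..<Suc k} - {i}. ?w i j) + (\<Sum>j<k. ?w k j)"
    by (simp only: interaction_def sum.lessThan_Suc)
  also have "(\<Sum>i<k. \<Sum>j\<in>{..<Suc k} - {i}. ?w i j) = (\<Sum>i<k. ?w i k + (\<Sum>j\<in>{..<k} - {i}. ?w i j))"
    by (intro sum.cong refl *) auto
  also have "\<dots> + (\<Sum>j<k. ?w k j) = interaction {..<k} x + 2 * (\<Sum>i<k. ?w i k)"
    unfolding sum.distrib interaction_def mult_2 norm_minus_commute[of "x k"] by (simp only: add_ac)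
  also have "\<dots> = 2 * coulomb_cost (Suc k) x"
    by (simp add: Suc coulomb_cost_def distrib_left)
  finally show ?case .
qed

text \<open>The factor 2 is neither 0 nor infinite, so it cancels in \<open>ennreal\<close>.\<close>

lemma coulomb_cost_eqI:
  "interaction {..<k} x = interaction {..<m} y \<Longrightarrow> coulomb_cost k x = coulomb_cost m y"
  by (simp add: interaction_lessThan ennreal_mult_cancel_left)

lemma coulomb_cost_leI:
  "interaction {..<k} x \<le> interaction {..<m} y \<Longrightarrow> coulomb_cost k x \<le> coulomb_cost m y"
  by (simp add: interaction_lessThan ennreal_mult_le_mult_iff)

lemma interaction_reindex:
  assumes "bij_betw f J I"
  shows "interaction J (\<lambda>i. x (f i)) = interaction I x"
proof -
  have inner: "(\<Sum>j\<in>J - {i}. 1 / ennreal (norm (x (f i) - x (f j)))) =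
      (\<Sum>j\<in>I - {f i}. 1 / ennreal (norm (x (f i) - x j)))" if "i \<in> J" for i
    using bij_betw_DiffI[OF assms bij_betw_singletonI[of f i "f i"]] that assms
    by (intro sum.reindex_bij_betw) (auto simp: bij_betw_def)
  show ?thesis
    unfolding interaction_def
    by (subst sum.reindex_bij_betw[OF assms, symmetric]) (simp add: inner cong: sum.cong)
qed

lemma interaction_mono:
  assumes "finite J" and "I \<subseteq> J"
  shows "interaction I x \<le> interaction J x"
proof -
  have "interaction I x \<le> (\<Sum>i\<in>I. \<Sum>j\<in>J - {i}. 1 / ennreal (norm (x i - x j)))"
    unfolding interaction_def using assms by (intro sum_mono sum_mono2) auto
  also have "\<dots> \<le> interaction J x"
    unfolding interaction_def using assms by (intro sum_mono2) auto
  finally show ?thesis .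
qed

lemma coulomb_cost_cong: "(\<And>i. i < k \<Longrightarrow> x i = y i) \<Longrightarrow> coulomb_cost k x = coulomb_cost k y"
  unfolding coulomb_cost_def by (intro sum.cong) auto

text \<open>Continuity holds at collisions too, because inversion on \<open>ennreal\<close> is
  continuous with value infinity at 0. The topology is that of the product, which suits the
  compactness argument below.\<close>

lemma continuous_on_coulomb_cost:
  "continuous_on UNIV (\<lambda>x :: nat \<Rightarrow> real ^ 'd. enn2ereal (coulomb_cost k x))"
proof -
  have "continuous_on UNIV (\<lambda>x :: nat \<Rightarrow> real ^ 'd. coulomb_cost k x)"
    unfolding coulomb_cost_def divide_ennreal_def mult_1
    by (intro continuous_on_sum continuous_on_inverse_ennreal continuous_on_ennreal
          continuous_on_norm continuous_on_diff continuous_on_product_coordinates)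
  then show ?thesis
    by (rule continuous_on_compose2[OF continuous_on_enn2ereal]) auto
qed

section \<open>Sending particles to infinity\<close>

text \<open>All particles from index \<open>k\<close> on run along one coordinate axis, chosen
  arbitrarily. The speed \<open>Suc i\<close> depends on the particle, so escaping particles also
  move away from each other.\<close>

definition escape :: "nat \<Rightarrow> (nat \<Rightarrow> real ^ 'd) \<Rightarrow> nat \<Rightarrow> nat \<Rightarrow> real ^ 'd" where
  "escape k x n i = (if i < k then x i else (real (Suc n) * real (Suc i)) *\<^sub>R axis undefined 1)"

lemma filterlim_escape:
  assumes "k \<le> i"
  shows "filterlim (\<lambda>n. escape k x n i) at_infinity sequentially"
proof -
  have "filterlim (\<lambda>n. norm (escape k x n i)) at_top sequentially"
  proof (rule filterlim_at_top_mono[OF filterlim_real_sequentially], intro always_eventually allI)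
    fix n
    have "real n * 1 \<le> real (Suc n) * real (Suc i)"
      by (intro mult_mono) auto
    then show "real n \<le> norm (escape k x n i)"
      using assms by (simp add: escape_def)
  qed
  then show ?thesis
    by (rule filterlim_norm_at_top_imp_at_infinity)
qed

text \<open>The particle \<open>j\<close> escapes. If \<open>i\<close> stays, the difference is a
  fixed translate of an escaping point; otherwise both lie on one ray at distance
  \<open>Suc n * (j - i)\<close>.\<close>

lemma filterlim_escape_diff:
  assumes "i < j" and "k \<le> j"
  shows "filterlim (\<lambda>n. norm (escape k x n i - escape k x n j)) at_top sequentially"
proof (cases "i < k")
  case True
  have "filterlim (\<lambda>n. - x i + escape k x n j) at_infinity sequentially"
    by (intro tendsto_add_filterlim_at_infinity[OF tendsto_const] filterlim_escape assms)
  then have "filterlim (\<lambda>n. norm (- x i + escape k x n j)) at_top sequentially"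
    by (rule filterlim_compose[OF filterlim_norm_at_top])
  moreover have "norm (- x i + escape k x n j) = norm (escape k x n i - escape k x n j)" for n
    using True by (metis escape_def norm_minus_commute uminus_add_conv_diff)
  ultimately show ?thesis by simp
next
  case False
  show ?thesis
  proof (rule filterlim_at_top_mono[OF filterlim_real_sequentially], intro always_eventually allI)
    fix n
    have "real n * 1 \<le> real (Suc n) * (real j - real i)"
      using assms by (intro mult_mono) auto
    also have "\<dots> = \<bar>real (Suc n) * (real i - real j)\<bar>"
      using assms by (simp add: abs_mult)
    also have "\<dots> = \<bar>real (Suc n) * real (Suc i) - real (Suc n) * real (Suc j)\<bar>"
      by (simp flip: right_diff_distrib)
    also have "\<dots> = norm (escape k x n i - escape k x n j)"
      using False assms by (simp add: escape_def flip: scaleR_diff_left)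
    finally show "real n \<le> norm (escape k x n i - escape k x n j)" by simp
  qed
qed

lemma tendsto_inverse_ennreal_at_top:
  assumes "filterlim f at_top F"
  shows "((\<lambda>n. 1 / ennreal (f n)) \<longlongrightarrow> 0) F"
proof -
  have "((\<lambda>n. ennreal (1 / f n)) \<longlongrightarrow> ennreal 0) F"
    using assms
    by (intro tendsto_ennrealI tendsto_divide_0[OF tendsto_const] filterlim_at_top_imp_at_infinity)
  \<comment> \<open>Real and extended division agree only for positive \<open>f n\<close>: at
    \<open>f n \<le> 0\<close> the left side is 0 and the right side is infinite.\<close>
  moreover have "\<forall>\<^sub>F n in F. 0 < f n"
    using assms by (simp add: filterlim_at_top_dense)
  then have "\<forall>\<^sub>F n in F. ennreal (1 / f n) = 1 / ennreal (f n)"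
    by eventually_elim (simp flip: divide_ennreal ennreal_1)
  ultimately show ?thesis
    by (auto intro: Lim_transform_eventually)
qed

text \<open>Pairs are indexed by their larger index \<open>j\<close>: for \<open>j < k\<close> both
  particles stay fixed, otherwise their distance diverges and the term tends to 0.\<close>

lemma coulomb_cost_escape:
  assumes "k \<le> N"
  shows "(\<lambda>n. coulomb_cost N (escape k x n)) \<longlonglongrightarrow> coulomb_cost k x"
proof -
  let ?w = "\<lambda>i j. 1 / ennreal (norm (x i - x j))"
  have "(\<lambda>n. coulomb_cost N (escape k x n)) \<longlonglongrightarrow> (\<Sum>j<N. \<Sum>i<j. if j < k then ?w i j else 0)"
    unfolding coulomb_cost_def
  proof (intro tendsto_sum)
    fix i j :: nat assume "i \<in> {..<j}"
    then show "(\<lambda>n. 1 / ennreal (norm (escape k x n i - escape k x n j)))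
        \<longlonglongrightarrow> (if j < k then ?w i j else 0)"
      using tendsto_inverse_ennreal_at_top[OF filterlim_escape_diff[of i j k x]]
      by (cases "j < k") (auto simp: escape_def)
  qed
  also have "(\<Sum>j<N. \<Sum>i<j. if j < k then ?w i j else 0) = (\<Sum>j<k. \<Sum>i<j. if j < k then ?w i j else 0)"
    using assms by (intro sum.mono_neutral_right) auto
  also have "\<dots> = coulomb_cost k x"
    unfolding coulomb_cost_def by (intro sum.cong) auto
  finally show ?thesis .
qed

lemma sum_escape:
  assumes "k \<le> N" and "\<phi> \<in> C0"
  shows "(\<lambda>n. \<Sum>i<N. \<phi> (escape k x n i)) \<longlonglongrightarrow> (\<Sum>i<k. \<phi> (x i))"
proof -
  have "(\<lambda>n. \<Sum>i<N. \<phi> (escape k x n i)) \<longlonglongrightarrow> (\<Sum>i<N. if i < k then \<phi> (x i) else 0)"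
  proof (intro tendsto_sum)
    fix i :: nat
    show "(\<lambda>n. \<phi> (escape k x n i)) \<longlonglongrightarrow> (if i < k then \<phi> (x i) else 0)"
      using C0_tendsto_zero[OF assms(2) filterlim_escape[of k i x]]
      by (cases "i < k") (auto simp: escape_def)
  qed
  also have "(\<Sum>i<N. if i < k then \<phi> (x i) else 0) = (\<Sum>i<k. if i < k then \<phi> (x i) else 0)"
    using assms by (intro sum.mono_neutral_right) auto
  also have "\<dots> = (\<Sum>i<k. \<phi> (x i))"
    by (intro sum.cong) auto
  finally show ?thesis .
qed

section \<open>The finite-particle functionals\<close>

definition config_value :: "(real ^ 'd \<Rightarrow> real) \<Rightarrow> nat \<Rightarrow> (nat \<Rightarrow> real ^ 'd) \<Rightarrow> ereal" where
  "config_value \<phi> k x = ereal (\<Sum>i<k. \<phi> (x i)) - enn2ereal (coulomb_cost k x)"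

definition best_value :: "(real ^ 'd \<Rightarrow> real) \<Rightarrow> nat \<Rightarrow> ereal" where
  "best_value \<phi> k = (SUP x. config_value \<phi> k x)"

text \<open>The factor \<open>k / N\<close> cancels the average \<open>1 / k\<close>, so one
  potential \<open>V / N\<close> with unnormalised sums makes all particle numbers comparable. At
  \<open>k = 0\<close> both sides are 0.\<close>

lemma sup_functional_eq_best_value:
  "sup_functional k (\<lambda>x. real k / real N * V x) = best_value (\<lambda>x. V x / real N) k"
proof (cases "k = 0")
  case True
  then show ?thesis
    by (simp add: sup_functional_def best_value_def config_value_def coulomb_cost_def zero_ennreal.rep_eq)
next
  case False
  then have "1 / real k * (\<Sum>i<k. real k / real N * V (x i)) = (\<Sum>i<k. V (x i) / real N)" for x
    by (simp add: sum_distrib_left)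
  with False show ?thesis
    by (simp add: sup_functional_def best_value_def config_value_def)
qed

lemma config_value_le_best_value: "config_value \<phi> k x \<le> best_value \<phi> k"
  unfolding best_value_def by (rule SUP_upper) simp

lemma best_value_0: "best_value \<phi> 0 = 0"
  by (simp add: best_value_def config_value_def coulomb_cost_def zero_ennreal.rep_eq)

text \<open>Any \<open>k\<close>-particle value is the limit of \<open>m\<close>-particle values in
  which the \<open>m - k\<close> additional particles escape.\<close>

lemma best_value_mono:
  assumes "\<phi> \<in> C0" and "k \<le> m"
  shows "best_value \<phi> k \<le> best_value \<phi> m"
  unfolding best_value_def[of \<phi> k]
proof (rule SUP_least)
  fix x
  \<comment> \<open>The limit of the potential term is finite, so the limits may be added even when
    the cost is infinite.\<close>
  have "(\<lambda>n. ereal (\<Sum>i<m. \<phi> (escape k x n i)) + - enn2ereal (coulomb_cost m (escape k x n)))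
      \<longlonglongrightarrow> ereal (\<Sum>i<k. \<phi> (x i)) + - enn2ereal (coulomb_cost k x)"
    using assms
    by (intro tendsto_add_ereal_general2 tendsto_uminus_ereal tendsto_enn2erealI tendsto_ereal
          sum_escape coulomb_cost_escape) auto
  then have "(\<lambda>n. config_value \<phi> m (escape k x n)) \<longlonglongrightarrow> config_value \<phi> k x"
    by (simp add: config_value_def minus_ereal_def)
  then show "config_value \<phi> k x \<le> best_value \<phi> m"
    by (rule LIMSEQ_le_const2) (auto intro: config_value_le_best_value)
qed

lemma best_value_nonneg: "\<phi> \<in> C0 \<Longrightarrow> 0 \<le> best_value \<phi> k"
  using best_value_mono[of \<phi> 0 k] by (simp add: best_value_0)

lemma best_value_finite:
  assumes "\<phi> \<in> C0"
  obtains g where "best_value \<phi> k = ereal g"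
proof -
  obtain B where B: "\<And>x. \<bar>\<phi> x\<bar> \<le> B"
    using C0_bounded[OF assms] by blast
  have "best_value \<phi> k \<le> ereal (\<Sum>i<k. B)"
    unfolding best_value_def config_value_def
  proof (rule SUP_least)
    fix x
    have "ereal (\<Sum>i<k. \<phi> (x i)) - enn2ereal (coulomb_cost k x) \<le> ereal (\<Sum>i<k. B) - 0"
      using B by (intro ereal_minus_mono) (auto intro!: sum_mono simp: abs_le_iff simp del: sum_constant)
    then show "ereal (\<Sum>i<k. \<phi> (x i)) - enn2ereal (coulomb_cost k x) \<le> ereal (\<Sum>i<k. B)"
      by (simp del: sum_constant)
  qed
  with best_value_nonneg[OF assms, of k] show ?thesis
    by (cases "best_value \<phi> k") (auto intro: that)
qed

lemma best_value_1_pos: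
  assumes "\<phi> x > 0"
  shows "0 < best_value \<phi> 1"
proof -
  have "config_value \<phi> 1 (\<lambda>_. x) = ereal (\<phi> x)"
    by (simp add: config_value_def coulomb_cost_def zero_ennreal.rep_eq)
  then show ?thesis
    using config_value_le_best_value[of \<phi> 1 "\<lambda>_. x"] assms
    by (metis ereal_less(2) less_le_trans)
qed

lemma best_value_nonpos:
  assumes "\<And>x. \<phi> x \<le> 0"
  shows "best_value \<phi> k \<le> 0"
  unfolding best_value_def config_value_def
proof (rule SUP_least)
  fix x
  have "ereal (\<Sum>i<k. \<phi> (x i)) - enn2ereal (coulomb_cost k x) \<le> 0 - 0"
    using assms by (intro ereal_minus_mono) (auto intro!: sum_nonpos)
  then show "ereal (\<Sum>i<k. \<phi> (x i)) - enn2ereal (coulomb_cost k x) \<le> 0" by simp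
qed

text \<open>Discarding the particles outside the ball can only lower the Coulomb cost, and costs at
  most \<open>\<eta>\<close> of potential energy per particle.\<close>

lemma config_value_le_best_value_in_ball:
  assumes "\<And>x. R < norm x \<Longrightarrow> \<phi> x \<le> \<eta>" and "0 \<le> \<eta>"
  shows "config_value \<phi> m x \<le> best_value \<phi> (card {i. i < m \<and> norm (x i) \<le> R}) + ereal (real m * \<eta>)"
proof -
  define I where "I = {i. i < m \<and> norm (x i) \<le> R}"
  have I: "I \<subseteq> {..<m}" "finite I"
    by (auto simp: I_def)
  \<comment> \<open>Relabel the particles in the ball by an initial segment, so that
    \<open>y\<close> is a configuration of \<open>card I\<close> particles.\<close>
  obtain f where f: "bij_betw f {..<card I} I"
    using ex_bij_betw_nat_finite[OF I(2)] by (auto simp: atLeast0LessThan)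
  define y where "y = (\<lambda>i. x (f i))"
  have cost: "coulomb_cost (card I) y \<le> coulomb_cost m x"
    using interaction_mono[of "{..<m}" I x] I unfolding y_def
    by (intro coulomb_cost_leI) (simp add: interaction_reindex[OF f])
  have "(\<Sum>i<m. \<phi> (x i)) = (\<Sum>i\<in>I. \<phi> (x i)) + (\<Sum>i\<in>{..<m} - I. \<phi> (x i))"
    using I by (subst sum.subset_diff[of I]) auto
  also have "(\<Sum>i\<in>I. \<phi> (x i)) = (\<Sum>i<card I. \<phi> (y i))"
    unfolding y_def by (rule sum.reindex_bij_betw[OF f, symmetric])
  also have "(\<Sum>i\<in>{..<m} - I. \<phi> (x i)) \<le> real (card ({..<m} - I)) * \<eta>"
    using assms(1) by (intro sum_bounded_above) (auto simp: I_def)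
  also have "\<dots> \<le> real m * \<eta>"
    using assms(2) card_mono[of "{..<m}" "{..<m} - I"] by (intro mult_right_mono) auto
  finally have "(\<Sum>i<m. \<phi> (x i)) \<le> (\<Sum>i<card I. \<phi> (y i)) + real m * \<eta>" by simp
  then have "config_value \<phi> m x
      \<le> ereal ((\<Sum>i<card I. \<phi> (y i)) + real m * \<eta>) - enn2ereal (coulomb_cost (card I) y)"
    unfolding config_value_def using cost by (intro ereal_minus_mono) (auto simp: less_eq_ennreal.rep_eq)
  also have "\<dots> = config_value \<phi> (card I) y + ereal (real m * \<eta>)"
    unfolding config_value_def by (cases "enn2ereal (coulomb_cost (card I) y)") auto
  also have "\<dots> \<le> best_value \<phi> (card I) + ereal (real m * \<eta>)"
    by (intro add_right_mono config_value_le_best_value)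
  finally show ?thesis
    unfolding I_def .
qed

text \<open>With at most \<open>k - 1\<close> particles in the ball, monotonicity bounds the value
  by \<open>best_value \<phi> (k - 1)\<close> plus the small potential outside. The total
  \<open>m\<close> is independent of \<open>k\<close>: it is taken as \<open>k\<close> for
  attainment and as \<open>N\<close> for the mass bound.\<close>

lemma config_value_gap:
  fixes \<phi> :: "real ^ 'd \<Rightarrow> real"
  assumes "\<phi> \<in> C0" and "best_value \<phi> (k - 1) < ereal g" and "0 < k"
  obtains R \<delta> where "0 < \<delta>"
    and "\<And>x. card {i. i < m \<and> norm (x i) \<le> R} < k \<Longrightarrow> config_value \<phi> m x \<le> ereal (g - \<delta>)"
proof -
  obtain g' where g': "best_value \<phi> (k - 1) = ereal g'"
    using best_value_finite[OF assms(1)] by blast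
  \<comment> \<open>\<open>m\<close> outer particles gain at most half the gap, leaving the other
    half as \<open>\<delta>\<close>; \<open>Suc m\<close> avoids division by zero.\<close>
  define \<eta> where "\<eta> = (g - g') / (2 * real (Suc m))"
  have pos: "0 < \<eta>"
    using assms(2) unfolding \<eta>_def g' by (intro divide_pos_pos) simp_all
  obtain R where R: "\<And>x. R < norm x \<Longrightarrow> \<bar>\<phi> x\<bar> < \<eta>"
    using C0_small_outside_ball[OF assms(1) pos] by blast
  show ?thesis
  proof
    show "0 < (g - g') / 2"
      using assms(2) unfolding g' by simp
    fix x :: "nat \<Rightarrow> real ^ 'd"
    assume less: "card {i. i < m \<and> norm (x i) \<le> R} < k"
    have "config_value \<phi> m x \<le> best_value \<phi> (card {i. i < m \<and> norm (x i) \<le> R}) + ereal (real m * \<eta>)"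
      using R pos by (intro config_value_le_best_value_in_ball) (auto simp: abs_less_iff less_imp_le)
    also have "\<dots> \<le> ereal g' + ereal (real m * \<eta>)"
      unfolding g'[symmetric] using less by (intro add_right_mono best_value_mono assms(1)) auto
    also have "\<dots> \<le> ereal (g' + real (Suc m) * \<eta>)"
      using pos by simp
    also have "real (Suc m) * \<eta> = (g - g') / 2"
      unfolding \<eta>_def by (simp add: field_simps)
    finally show "config_value \<phi> m x \<le> ereal (g - (g - g') / 2)"
      by (simp add: field_simps)
  qed
qed

section \<open>Attainment of the supremum by compactness\<close>

lemma continuous_on_config_value:
  assumes "\<phi> \<in> C0"
  shows "continuous_on A (config_value \<phi> k)"
proof -
  have sum: "continuous_on UNIV (\<lambda>x :: nat \<Rightarrow> _. \<Sum>i<k. \<phi> (x i))"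
    by (intro continuous_on_sum continuous_on_compose2[OF C0_continuous[OF assms]]
        continuous_on_product_coordinates) auto
  have "((\<lambda>x. ereal (\<Sum>i<k. \<phi> (x i)) + - enn2ereal (coulomb_cost k x))
      \<longlongrightarrow> ereal (\<Sum>i<k. \<phi> (x i)) + - enn2ereal (coulomb_cost k x)) (at x)" for x
    using sum continuous_on_coulomb_cost[of k]
    by (intro tendsto_add_ereal_general2 tendsto_uminus_ereal tendsto_ereal)
       (auto simp: continuous_on_def)
  then have "continuous_on UNIV (config_value \<phi> k)"
    unfolding continuous_on_def config_value_def minus_ereal_def by auto
  then show ?thesis
    by (rule continuous_on_subset) auto
qed

text \<open>Tychonoff: bounding every coordinate, also those carrying no particle, gives a full
  product of compact balls.\<close>

lemma compact_cball_configs: "compact {x :: nat \<Rightarrow> real ^ 'd. \<forall>i. norm (x i) \<le> R}"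
proof -
  have "compactin (product_topology (\<lambda>i :: nat. euclidean) UNIV) (PiE UNIV (\<lambda>i. cball 0 R :: (real ^ 'd) set))"
    by (simp add: compactin_PiE)
  moreover have "PiE UNIV (\<lambda>i. cball 0 R) = {x :: nat \<Rightarrow> real ^ 'd. \<forall>i. norm (x i) \<le> R}"
    by (auto simp: PiE_UNIV_domain)
  ultimately show ?thesis
    by (simp add: euclidean_product_topology)
qed

text \<open>The strict increase at \<open>k\<close> keeps configurations with a particle outside a
  large ball below \<open>g - \<delta>\<close>; on the remaining ones a continuous function is
  maximized over a compact set.\<close>

lemma best_value_attained:
  fixes \<phi> :: "real ^ 'd \<Rightarrow> real"
  assumes "\<phi> \<in> C0" and "0 < k \<Longrightarrow> best_value \<phi> (k - 1) < best_value \<phi> k"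
  obtains x where "config_value \<phi> k x = best_value \<phi> k"
proof (cases "k = 0")
  case True
  then show ?thesis
    by (intro that[of undefined])
       (simp add: best_value_0 config_value_def coulomb_cost_def zero_ennreal.rep_eq)
next
  case False
  obtain g where g: "best_value \<phi> k = ereal g"
    using best_value_finite[OF assms(1)] by blast
  obtain R \<delta> where "0 < \<delta>"
    and far: "\<And>x. card {i. i < k \<and> norm (x i) \<le> R} < k \<Longrightarrow> config_value \<phi> k x \<le> ereal (g - \<delta>)"
    using config_value_gap[OF assms(1), of k g k] assms(2) False unfolding g by blast
  \<comment> \<open>\<open>max R 0\<close> keeps the zero configuration in \<open>K\<close> even if
    \<open>R\<close> is negative.\<close>
  define K where "K = {x :: nat \<Rightarrow> real ^ 'd. \<forall>i. norm (x i) \<le> max R 0}"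
  have "compact K" "K \<noteq> {}"
    using compact_cball_configs[of "max R 0"] by (auto simp: K_def intro!: exI[of _ "\<lambda>_. 0"])
  then obtain x where x: "\<And>y. y \<in> K \<Longrightarrow> config_value \<phi> k y \<le> config_value \<phi> k x"
    using continuous_attains_sup[of K "config_value \<phi> k"] continuous_on_config_value[OF assms(1)]
    by blast
  have "config_value \<phi> k y \<le> max (config_value \<phi> k x) (ereal (g - \<delta>))" for y
  proof (cases "\<forall>i<k. norm (y i) \<le> R")
    case True
    \<comment> \<open>Setting the irrelevant coordinates to 0 puts the configuration into
      \<open>K\<close> without changing its value.\<close>
    define z where "z = (\<lambda>i. if i < k then y i else 0)"
    have "config_value \<phi> k y = config_value \<phi> k z"
      using coulomb_cost_cong[of k y z] by (simp add: config_value_def z_def)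
    also have "\<dots> \<le> config_value \<phi> k x"
      using True by (intro x) (auto simp: K_def z_def)
    finally show ?thesis
      by (simp add: le_max_iff_disj)
  next
    case False
    then have "{i. i < k \<and> norm (y i) \<le> R} \<subset> {..<k}" by auto
    then have "card {i. i < k \<and> norm (y i) \<le> R} < k"
      using psubset_card_mono[OF finite_lessThan] by (metis card_lessThan)
    then show ?thesis
      using far by (simp add: le_max_iff_disj)
  qed
  \<comment> \<open>Pass to the supremum over \<open>y\<close>; as \<open>\<delta> > 0\<close>, only
    the first entry of the maximum can reach \<open>g\<close>.\<close>
  then have "ereal g \<le> max (config_value \<phi> k x) (ereal (g - \<delta>))"
    unfolding g[symmetric] best_value_def[of \<phi> k] by (intro SUP_least)
  then have "ereal g \<le> config_value \<phi> k x"
    using \<open>0 < \<delta>\<close> by (auto simp: le_max_iff_disj)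
  then show ?thesis
    using config_value_le_best_value[of \<phi> k x] by (intro that[of x] antisym) (auto simp: g)
qed

section \<open>The critical index as the last strict increase\<close>

lemma critical_index:
  fixes V :: "real ^ 'd \<Rightarrow> real"
  assumes "0 < N" and "V \<in> C0"
  defines "\<phi> \<equiv> \<lambda>x. V x / real N" and "k \<equiv> critical_index N V"
  shows "k \<le> N" and "best_value \<phi> k = best_value \<phi> N"
    and "0 < k \<Longrightarrow> best_value \<phi> (k - 1) < best_value \<phi> k"
proof -
  have \<phi>: "\<phi> \<in> C0"
    unfolding \<phi>_def by (intro C0_divide assms)
  have "k \<le> N \<and> best_value \<phi> k = best_value \<phi> N
      \<and> (0 < k \<longrightarrow> best_value \<phi> (k - 1) < best_value \<phi> k)"
  proof (cases "\<forall>x. max (V x) 0 = 0")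
    case True
    then have "\<phi> x \<le> 0" for x
      using assms(1) by (auto simp: \<phi>_def divide_le_0_iff max_def split: if_splits intro: less_imp_le)
    then have "best_value \<phi> N = 0"
      using best_value_nonpos[of \<phi> N] best_value_nonneg[OF \<phi>, of N] by (intro antisym) blast+
    with True show ?thesis
      by (simp add: k_def critical_index_def best_value_0)
  next
    case False
    define S where "S = {k \<in> {1..N}. best_value \<phi> (k - 1) < best_value \<phi> k}"
    have k: "k = Max S"
      unfolding k_def critical_index_def sup_functional_eq_best_value S_def \<phi>_def
      using False by (simp only: if_False)
    obtain x where "0 < V x"
      using False by (metis max.absorb2 not_le)
    \<comment> \<open>A point with \<open>V > 0\<close> makes one particle better than none, so
      \<open>S\<close> is nonempty and its \<open>Max\<close> is a genuine maximum.\<close>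
    then have "1 \<in> S"
      using assms(1) best_value_1_pos[of \<phi> x] by (simp add: S_def best_value_0 \<phi>_def)
    moreover have "finite S"
      by (simp add: S_def)
    ultimately have "k \<in> S" and max: "\<And>j. j \<in> S \<Longrightarrow> j \<le> k"
      unfolding k using Max_in by (blast, simp)
    \<comment> \<open>Beyond the largest strict increase, monotonicity leaves only equality.\<close>
    have "best_value \<phi> k = best_value \<phi> j" if "k \<le> j" "j \<le> N" for j
      using that
    proof (induction rule: dec_induct)
      case (step j)
      then have "Suc j \<notin> S"
        using max by fastforce
      with step best_value_mono[OF \<phi>, of j "Suc j"] show ?case
        by (auto simp: S_def)
    qed simp
    with \<open>k \<in> S\<close> show ?thesis
      by (auto simp: S_def)
  qed
  then show "k \<le> N" and "best_value \<phi> k = best_value \<phi> N"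
    and "0 < k \<Longrightarrow> best_value \<phi> (k - 1) < best_value \<phi> k"
    by auto
qed

section \<open>Lower bounds by duality\<close>

text \<open>\<open>ennreal\<close> truncates negative values to 0, so the comparison passes through
  the positive part of \<open>h\<close>.\<close>

lemma integral_le_nn_integral:
  fixes h :: "'a \<Rightarrow> real"
  assumes "integrable M h" and "\<And>x. x \<in> space M \<Longrightarrow> ennreal (h x) \<le> c x"
  shows "ennreal (integral\<^sup>L M h) \<le> (\<integral>\<^sup>+ x. c x \<partial>M)"
proof -
  have "integral\<^sup>L M h \<le> (\<integral>x. max (h x) 0 \<partial>M)"
    using assms(1) by (intro integral_mono) auto
  then have "ennreal (integral\<^sup>L M h) \<le> (\<integral>\<^sup>+ x. ennreal (max (h x) 0) \<partial>M)"
    using assms(1) by (subst nn_integral_eq_integral) (auto intro: ennreal_leI)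
  also have "\<dots> \<le> (\<integral>\<^sup>+ x. c x \<partial>M)"
    using assms(2) by (intro nn_integral_mono) (auto simp: max_def ennreal_neg)
  finally show ?thesis .
qed

text \<open>A lower bound of the cost by a sum of one-particle potentials integrates to a bound which is
  affine in \<open>\<rho>\<close>, and therefore survives the relaxation.\<close>

lemma mot_cost_ge:
  fixes \<phi> :: "real ^ 'd \<Rightarrow> real"
  assumes \<phi>: "\<phi> \<in> C0" and le: "\<And>x. ennreal (a + (\<Sum>i<N. \<phi> (x i))) \<le> coulomb_cost N x"
  shows "ennreal (a + real N * integral\<^sup>L \<rho> \<phi>) \<le> mot_cost N \<rho>"
  unfolding mot_cost_def
proof (rule INF_greatest)
  fix P assume "P \<in> transport_plans N \<rho>"
  then have sets [measurable_cong]: "sets P = sets (\<Pi>\<^sub>M i\<in>{..<N}. borel)" and "prob_space P"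
    and marginal: "\<And>i. i < N \<Longrightarrow> distr P borel (\<lambda>x. x i) = \<rho>"
    by (auto simp: transport_plans_def)
  interpret prob_space P by fact
  have [measurable]: "(\<lambda>x. x i) \<in> borel_measurable P" if "i < N" for i
    using measurable_component_singleton[of i "{..<N}" "\<lambda>_. borel"] that
    by (simp cong: measurable_cong_sets)
  have int: "integrable P (\<lambda>x. \<phi> (x i))" if "i < N" for i
    using that by (intro C0_integrable \<phi> finite_measure_axioms) auto
  have "integral\<^sup>L P (\<lambda>x. \<phi> (x i)) = integral\<^sup>L \<rho> \<phi>" if "i < N" for i
    unfolding marginal[OF that, symmetric] using that
    by (intro integral_distr[symmetric] borel_measurable_continuous_onI C0_continuous \<phi>) auto
  then have "(\<integral>x. a + (\<Sum>i<N. \<phi> (x i)) \<partial>P) = a + real N * integral\<^sup>L \<rho> \<phi>"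
    using int by (subst Bochner_Integration.integral_add) (auto simp: prob_space Bochner_Integration.integral_sum)
  moreover have "integrable P (\<lambda>x. a + (\<Sum>i<N. \<phi> (x i)))"
    using int by (intro Bochner_Integration.integrable_add Bochner_Integration.integrable_sum) auto
  ultimately show "ennreal (a + real N * integral\<^sup>L \<rho> \<phi>) \<le> (\<integral>\<^sup>+ x. coulomb_cost N x \<partial>P)"
    using integral_le_nn_integral[of P "\<lambda>x. a + (\<Sum>i<N. \<phi> (x i))" "coulomb_cost N"] le
    by metis
qed

text \<open>Testing against \<open>\<phi>\<close> passes to the weak* limit. The constant
  \<open>a\<close> is not scaled by the mass of \<open>\<rho>\<close>, so the bound keeps its form
  even when mass is lost.\<close>

lemma relaxed_cost_ge:
  fixes \<phi> :: "real ^ 'd \<Rightarrow> real"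
  assumes \<phi>: "\<phi> \<in> C0" and le: "\<And>x. ennreal (a + (\<Sum>i<N. \<phi> (x i))) \<le> coulomb_cost N x"
  shows "ennreal (a + real N * integral\<^sup>L \<rho> \<phi>) \<le> relaxed_cost N \<rho>"
  unfolding relaxed_cost_def
proof (rule Inf_greatest, safe)
  fix \<rho>s :: "nat \<Rightarrow> (real ^ 'd) measure"
  assume "weak_star_conv \<rho>s \<rho>"
  then have "(\<lambda>n. ennreal (a + real N * integral\<^sup>L (\<rho>s n) \<phi>)) \<longlonglongrightarrow> ennreal (a + real N * integral\<^sup>L \<rho> \<phi>)"
    using \<phi> by (intro tendsto_intros) (auto simp: weak_star_conv_def)
  then have "ennreal (a + real N * integral\<^sup>L \<rho> \<phi>) = liminf (\<lambda>n. ennreal (a + real N * integral\<^sup>L (\<rho>s n) \<phi>))"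
    by (intro lim_imp_Liminf[symmetric]) auto
  also have "\<dots> \<le> liminf (\<lambda>n. mot_cost N (\<rho>s n))"
    by (intro Liminf_mono always_eventually allI mot_cost_ge assms)
  finally show "ennreal (a + real N * integral\<^sup>L \<rho> \<phi>) \<le> liminf (\<lambda>n. mot_cost N (\<rho>s n))" .
qed

lemma ennreal_le_cost_if_config_value_le:
  assumes "config_value \<phi> k x \<le> ereal g"
  shows "ennreal ((\<Sum>i<k. \<phi> (x i)) - g) \<le> coulomb_cost k x"
proof (cases "coulomb_cost k x")
  case (real c)
  then show ?thesis
    using assms by (simp add: config_value_def enn2ereal_ennreal ennreal_leI)
qed simp

lemma integral_scale_diff:
  fixes \<phi> \<psi> :: "real ^ 'd \<Rightarrow> real"
  assumes "\<phi> \<in> C0" and "\<psi> \<in> C0" and "finite_measure \<rho>" and "sets \<rho> = sets borel"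
  shows "(\<integral>x. a * \<phi> x - b * \<psi> x \<partial>\<rho>) = a * integral\<^sup>L \<rho> \<phi> - b * integral\<^sup>L \<rho> \<psi>"
proof -
  have [measurable]: "(\<lambda>x. x) \<in> borel_measurable \<rho>"
    using assms(4) by (simp cong: measurable_cong_sets)
  have "integrable \<rho> \<phi>" "integrable \<rho> \<psi>"
    using C0_integrable[OF _ assms(3), of _ "\<lambda>x. x"] assms by auto
  then show ?thesis by simp
qed

lemma subprob_measuresD:
  assumes "\<rho> \<in> subprob_measures"
  shows "sets \<rho> = sets borel" and "finite_measure \<rho>" and "space \<rho> = UNIV"
proof -
  show "sets \<rho> = sets borel"
    using assms by (simp add: subprob_measures_def)
  then show "space \<rho> = UNIV"
    by (metis sets_eq_imp_space_eq space_borel)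
  with assms show "finite_measure \<rho>"
    by (intro finite_measureI) (auto simp: subprob_measures_def top_unique)
qed

text \<open>Weak duality with constant \<open>- g\<close> and potential \<open>V / N\<close>: the
  pointwise bound is the definition of \<open>g\<close> as a supremum, and \<open>N\<close> copies
  of \<open>V / N\<close> integrate to the integral of \<open>V\<close>.\<close>

lemma energy_ge:
  fixes V :: "real ^ 'd \<Rightarrow> real"
  assumes "0 < N" and "V \<in> C0" and "\<rho> \<in> subprob_measures"
    and "best_value (\<lambda>x. V x / real N) N = ereal g"
  shows "ereal (- g) \<le> energy N V \<rho>"
proof -
  have \<phi>: "(\<lambda>x. V x / real N) \<in> C0"
    by (intro C0_divide assms)
  have "ennreal (- g + (\<Sum>i<N. V (x i) / real N)) \<le> coulomb_cost N x" for x
    using ennreal_le_cost_if_config_value_le[of "\<lambda>x. V x / real N" N x g]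
      config_value_le_best_value[of "\<lambda>x. V x / real N" N x] assms(4) by simp
  then have "ennreal (- g + real N * (\<integral>x. V x / real N \<partial>\<rho>)) \<le> relaxed_cost N \<rho>"
    by (rule relaxed_cost_ge[OF \<phi>])
  then have "ennreal (integral\<^sup>L \<rho> V - g) \<le> relaxed_cost N \<rho>"
    using assms(1) by simp
  then show ?thesis
    by (cases "relaxed_cost N \<rho>")
       (auto simp: energy_def enn2ereal_ennreal ennreal_le_iff2)
qed

text \<open>The potential may be lowered by a multiple of a cutoff function while staying below the
  cost, since a configuration with fewer than \<open>k\<close> particles in the ball is not close to optimal.\<close>

lemma measure_ge_if_energy_le:
  fixes V :: "real ^ 'd \<Rightarrow> real"
  assumes "0 < N" and "V \<in> C0" and \<rho>: "\<rho> \<in> subprob_measures" and "0 < k"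
    and g: "best_value (\<lambda>x. V x / real N) N = ereal g"
    and gap: "best_value (\<lambda>x. V x / real N) (k - 1) < ereal g"
    and energy: "energy N V \<rho> \<le> ereal (- g)"
  shows "real k / real N \<le> measure \<rho> UNIV"
proof -
  define \<phi> where "\<phi> = (\<lambda>x. V x / real N)"
  have \<phi>: "\<phi> \<in> C0"
    unfolding \<phi>_def by (intro C0_divide assms)
  note \<rho>' = subprob_measuresD[OF \<rho>]
  obtain R \<delta> where \<delta>: "0 < \<delta>"
    and far: "\<And>x. card {i. i < N \<and> norm (x i) \<le> R} < k \<Longrightarrow> config_value \<phi> N x \<le> ereal (g - \<delta>)"
    using config_value_gap[OF \<phi> gap[folded \<phi>_def] \<open>0 < k\<close>, of N] by blast
  define \<theta> :: "real ^ 'd \<Rightarrow> real" where "\<theta> = (\<lambda>x. max 0 (min 1 (R + 1 - norm x)))"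
  have \<theta>: "\<theta> \<in> C0"
    unfolding \<theta>_def by (rule C0_cutoff)
  \<comment> \<open>Chosen so that \<open>k\<close> particles in the ball lower the potential by
    exactly the gap \<open>\<delta>\<close>.\<close>
  define b where "b = \<delta> / real k"
  have b: "0 < b" "b * real k = \<delta>"
    using \<delta> \<open>0 < k\<close> by (auto simp: b_def)
  define \<psi> where "\<psi> = (\<lambda>x. 1 / real N * V x - b * \<theta> x)"
  have \<psi>: "\<psi> \<in> C0"
    unfolding \<psi>_def by (intro C0_diff_scale \<theta> assms)
  \<comment> \<open>The constant improves from \<open>- g\<close> to \<open>\<delta> - g\<close>:
    with fewer than \<open>k\<close> particles in the ball the gap pays for \<open>\<delta>\<close>,
    otherwise the lowering by \<open>b\<close> per particle does.\<close>
  have "ennreal (\<delta> - g + (\<Sum>i<N. \<psi> (x i))) \<le> coulomb_cost N x" for x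
  proof -
    let ?n = "card {i. i < N \<and> norm (x i) \<le> R}"
    have "real ?n = (\<Sum>i\<in>{i. i < N \<and> norm (x i) \<le> R}. \<theta> (x i))"
      by (simp add: \<theta>_def)
    also have "\<dots> \<le> (\<Sum>i<N. \<theta> (x i))"
      by (intro sum_mono2) (auto simp: \<theta>_def)
    finally have "b * real ?n \<le> b * (\<Sum>i<N. \<theta> (x i))"
      using b by simp
    then have sum: "\<delta> - g + (\<Sum>i<N. \<psi> (x i)) \<le> (\<Sum>i<N. \<phi> (x i)) - (g - \<delta> + b * real ?n)"
      by (simp add: \<psi>_def \<phi>_def sum_subtractf sum_distrib_left)
    have "config_value \<phi> N x \<le> ereal (g - \<delta> + b * real ?n)"
    proof (cases "?n < k")
      case True
      then have "config_value \<phi> N x \<le> ereal (g - \<delta>)" by (rule far)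
      also have "\<dots> \<le> ereal (g - \<delta> + b * real ?n)"
        using b by simp
      finally show ?thesis .
    next
      case False
      then have "b * real k \<le> b * real ?n"
        using b(1) by (intro mult_left_mono) auto
      then have "ereal g \<le> ereal (g - \<delta> + b * real ?n)"
        using b by simp
      with config_value_le_best_value[of \<phi> N x] show ?thesis
        unfolding \<phi>_def g by (rule order_trans)
    qed
    then have "ennreal ((\<Sum>i<N. \<phi> (x i)) - (g - \<delta> + b * real ?n)) \<le> coulomb_cost N x"
      by (rule ennreal_le_cost_if_config_value_le)
    with sum show ?thesis
      by (meson ennreal_leI order_trans)
  qed
  then have "ennreal (\<delta> - g + real N * integral\<^sup>L \<rho> \<psi>) \<le> relaxed_cost N \<rho>"
    by (rule relaxed_cost_ge[OF \<psi>])
  moreover have "integral\<^sup>L \<rho> \<psi> = 1 / real N * integral\<^sup>L \<rho> V - b * integral\<^sup>L \<rho> \<theta>"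
    unfolding \<psi>_def by (intro integral_scale_diff assms \<theta> \<rho>')
  ultimately have "ennreal (\<delta> - g + (integral\<^sup>L \<rho> V - real N * b * integral\<^sup>L \<rho> \<theta>)) \<le> relaxed_cost N \<rho>"
    using \<open>0 < N\<close> by (simp add: algebra_simps)
  \<comment> \<open>The upper bound on the energy makes the relaxed cost finite; the integral of
    \<open>V\<close> and the constant \<open>g\<close> then cancel.\<close>
  with energy have "\<delta> \<le> real N * b * integral\<^sup>L \<rho> \<theta>"
    by (cases "relaxed_cost N \<rho>")
       (auto simp: energy_def enn2ereal_ennreal ennreal_le_iff2)
  then have "b * real k \<le> b * (real N * integral\<^sup>L \<rho> \<theta>)"
    using b by (simp add: mult_ac)
  then have "real k \<le> real N * integral\<^sup>L \<rho> \<theta>"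
    using b(1) by (rule mult_left_le_imp_le)
  then have "real k / real N \<le> integral\<^sup>L \<rho> \<theta>"
    using \<open>0 < N\<close> by (simp add: field_simps)
  also have "\<dots> \<le> (\<integral>x. 1 \<partial>\<rho>)"
  proof (rule integral_mono)
    show "integrable \<rho> \<theta>"
      using C0_integrable[OF \<theta> \<rho>'(2), of "\<lambda>x. x"] \<rho>'(1) by (simp cong: measurable_cong_sets)
    show "integrable \<rho> (\<lambda>_. 1 :: real)"
      using \<rho>'(2) by (simp add: finite_measure.integrable_const)
  qed (simp add: \<theta>_def)
  also have "\<dots> = measure \<rho> UNIV"
    using \<rho>'(3) by simp
  finally show ?thesis .
qed

section \<open>Upper bounds by uniform measures on configurations\<close>

text \<open>Pushing forward the uniform law on indices counts coinciding points with
  multiplicity.\<close>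

definition empirical :: "nat \<Rightarrow> (nat \<Rightarrow> real ^ 'd) \<Rightarrow> (real ^ 'd) measure" where
  "empirical N y = distr (measure_pmf (pmf_of_set {..<N})) borel y"

lemma empirical_prob: "empirical N y \<in> prob_measures"
  unfolding empirical_def prob_measures_def
  by (auto intro!: prob_space.prob_space_distr measure_pmf.prob_space_axioms)

lemma integral_empirical:
  fixes \<phi> :: "real ^ 'd \<Rightarrow> real"
  assumes "0 < N" and "\<phi> \<in> borel_measurable borel"
  shows "integral\<^sup>L (empirical N y) \<phi> = (\<Sum>i<N. \<phi> (y i)) / real N"
  using assms unfolding empirical_def
  by (subst integral_distr) (auto simp: integral_pmf_of_set lessThan_empty_iff)

text \<open>Used in both roles: for a fixed shift it permutes the particles, for a fixed particle it
  permutes the shifts.\<close>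

lemma bij_betw_add_mod:
  "bij_betw (\<lambda>s. (i + s) mod N) {..<N} {..<N :: nat}"
proof (cases "N = 0")
  case False
  have "inj_on (\<lambda>s. (i + s) mod N) {..<N}"
  proof (rule linorder_inj_onI')
    fix s t assume "s \<in> {..<N}" "t \<in> {..<N}" "s < t"
    then have "\<not> N dvd (i + t) - (i + s)"
      by (auto dest: dvd_imp_le)
    then show "(i + s) mod N \<noteq> (i + t) mod N"
      using mod_eq_dvd_iff_nat[of "i + s" "i + t" N] \<open>s < t\<close> by auto
  qed
  moreover have "(\<lambda>s. (i + s) mod N) ` {..<N} \<subseteq> {..<N}"
    using False by auto
  ultimately show ?thesis
    by (simp add: bij_betw_def endo_inj_surj)
qed (simp add: bij_betw_def)

text \<open>The uniform distribution on the cyclic shifts of the configuration is a plan, and all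
  shifts have the same cost.\<close>

lemma mot_cost_empirical_le:
  fixes y :: "nat \<Rightarrow> real ^ 'd"
  assumes "0 < N"
  shows "mot_cost N (empirical N y) \<le> coulomb_cost N y"
proof -
  let ?U = "measure_pmf (pmf_of_set {..<N})"
  let ?shift = "\<lambda>s. \<lambda>i\<in>{..<N}. y ((i + s) mod N)"
  define P where "P = distr ?U (\<Pi>\<^sub>M i\<in>{..<N}. borel) ?shift"
  have shift [measurable]: "?shift \<in> ?U \<rightarrow>\<^sub>M (\<Pi>\<^sub>M i\<in>{..<N}. borel)"
    by (rule measurable_restrict) simp
  have invariant: "coulomb_cost N (?shift s) = coulomb_cost N y" for s
  proof -
    have "coulomb_cost N (?shift s) = coulomb_cost N (\<lambda>i. y ((s + i) mod N))"
      by (intro coulomb_cost_cong) (simp add: add.commute)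
    also have "\<dots> = coulomb_cost N y"
      by (intro coulomb_cost_eqI interaction_reindex bij_betw_add_mod)
    finally show ?thesis .
  qed
  \<comment> \<open>For fixed \<open>i\<close>, the index \<open>(i + s) mod N\<close> is uniform
    when the shift \<open>s\<close> is, so every coordinate has the same law.\<close>
  have "distr P borel (\<lambda>x. x i) = empirical N y" if "i < N" for i
  proof -
    have "distr P borel (\<lambda>x. x i) = distr ?U borel (\<lambda>s. y ((i + s) mod N))"
      using that unfolding P_def by (subst distr_distr) (auto simp: comp_def space_PiM)
    also have "\<dots> = distr (distr ?U (count_space UNIV) (\<lambda>s. (i + s) mod N)) borel y"
      by (subst distr_distr) (auto simp: comp_def)
    also have "distr ?U (count_space UNIV) (\<lambda>s. (i + s) mod N)
        = measure_pmf (map_pmf (\<lambda>s. (i + s) mod N) (pmf_of_set {..<N}))"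
      by (simp add: map_pmf_rep_eq)
    also have "map_pmf (\<lambda>s. (i + s) mod N) (pmf_of_set {..<N}) = pmf_of_set {..<N}"
      using assms by (intro map_pmf_of_set_bij_betw bij_betw_add_mod) auto
    finally show ?thesis
      by (simp add: empirical_def)
  qed
  moreover have "prob_space P"
    unfolding P_def by (intro prob_space.prob_space_distr measure_pmf.prob_space_axioms) measurable
  ultimately have "P \<in> transport_plans N (empirical N y)"
    by (simp add: transport_plans_def P_def)
  then have "mot_cost N (empirical N y) \<le> (\<integral>\<^sup>+ x. coulomb_cost N x \<partial>P)"
    unfolding mot_cost_def by (rule INF_lower)
  also have "\<dots> = (\<integral>\<^sup>+ s. coulomb_cost N (?shift s) \<partial>?U)"
  proof -
    have [measurable]: "(\<lambda>x. x i) \<in> borel_measurable (\<Pi>\<^sub>M i\<in>{..<N}. borel :: (real ^ 'd) measure)"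
      if "i < N" for i
      using that by (intro measurable_component_singleton) simp
    have cost: "coulomb_cost N \<in> borel_measurable (\<Pi>\<^sub>M i\<in>{..<N}. borel :: (real ^ 'd) measure)"
      unfolding coulomb_cost_def[abs_def]
      by (intro borel_measurable_sum borel_measurable_divide_ennreal) auto
    show ?thesis
      unfolding P_def by (rule nn_integral_distr[OF shift]) (use cost in simp)
  qed
  also have "\<dots> = coulomb_cost N y"
    by (simp only: invariant) simp
  finally show ?thesis .
qed

text \<open>Each of the \<open>k\<close> points keeps weight \<open>1 / N\<close>, so the total mass
  is \<open>k / N\<close>: this is what remains of \<open>N\<close> particles after
  \<open>N - k\<close> have escaped.\<close>

definition partial_empirical :: "nat \<Rightarrow> nat \<Rightarrow> (nat \<Rightarrow> real ^ 'd) \<Rightarrow> (real ^ 'd) measure" where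
  "partial_empirical N k x = distr (point_measure {..<k} (\<lambda>_. ennreal (1 / real N))) borel x"

lemma integral_partial_empirical:
  fixes \<phi> :: "real ^ 'd \<Rightarrow> real"
  assumes "\<phi> \<in> borel_measurable borel"
  shows "integral\<^sup>L (partial_empirical N k x) \<phi> = (\<Sum>i<k. \<phi> (x i)) / real N"
  using assms unfolding partial_empirical_def
  by (subst integral_distr)
     (auto simp: lebesgue_integral_point_measure_finite sum_divide_distrib)

lemma sets_partial_empirical [simp]: "sets (partial_empirical N k x) = sets borel"
  by (simp add: partial_empirical_def)

lemma emeasure_partial_empirical: "emeasure (partial_empirical N k x) UNIV = ennreal (real k / real N)"
  unfolding partial_empirical_def
  by (subst emeasure_distr)
     (auto simp: space_point_measure emeasure_point_measure_finite ennreal_mult[symmetric]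
           ennreal_of_nat_eq_real_of_nat)

text \<open>The empirical measures of \<open>escape k x n\<close> are a recovery sequence: they
  converge weakly*, and their costs are bounded by a sequence tending to
  \<open>coulomb_cost k x\<close>.\<close>

lemma relaxed_cost_partial_empirical_le:
  assumes "0 < N" and "k \<le> N"
  shows "relaxed_cost N (partial_empirical N k x) \<le> coulomb_cost k x"
proof -
  let ?\<rho> = "\<lambda>n. empirical N (escape k x n)"
  have "weak_star_conv ?\<rho> (partial_empirical N k x)"
    unfolding weak_star_conv_def
  proof
    fix \<phi> :: "real ^ 'a \<Rightarrow> real" assume \<phi>: "\<phi> \<in> C0"
    then have "\<phi> \<in> borel_measurable borel"
      by (intro borel_measurable_continuous_onI C0_continuous)
    moreover have "(\<lambda>n. (\<Sum>i<N. \<phi> (escape k x n i)) / real N) \<longlonglongrightarrow> (\<Sum>i<k. \<phi> (x i)) / real N"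
      using assms by (intro tendsto_intros sum_escape \<phi>) auto
    ultimately show "(\<lambda>n. integral\<^sup>L (?\<rho> n) \<phi>) \<longlonglongrightarrow> integral\<^sup>L (partial_empirical N k x) \<phi>"
      using assms by (simp add: integral_empirical integral_partial_empirical)
  qed
  then have "relaxed_cost N (partial_empirical N k x) \<le> liminf (\<lambda>n. mot_cost N (?\<rho> n))"
    unfolding relaxed_cost_def by (intro Inf_lower) (auto simp: empirical_prob)
  also have "\<dots> \<le> liminf (\<lambda>n. coulomb_cost N (escape k x n))"
    by (intro Liminf_mono always_eventually allI mot_cost_empirical_le assms)
  also have "\<dots> = coulomb_cost k x"
    by (intro lim_imp_Liminf coulomb_cost_escape assms) simp
  finally show ?thesis .
qed

lemma energy_partial_empirical_le:
  fixes V :: "real ^ 'd \<Rightarrow> real"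
  assumes "0 < N" and "k \<le> N" and "V \<in> C0"
    and "config_value (\<lambda>x. V x / real N) k x = ereal g"
  shows "energy N V (partial_empirical N k x) \<le> ereal (- g)"
proof -
  have "integral\<^sup>L (partial_empirical N k x) V = (\<Sum>i<k. V (x i)) / real N"
    by (intro integral_partial_empirical borel_measurable_continuous_onI C0_continuous assms)
  then have "energy N V (partial_empirical N k x)
      \<le> enn2ereal (coulomb_cost k x) - ereal (\<Sum>i<k. V (x i) / real N)"
    using relaxed_cost_partial_empirical_le[OF assms(1,2), of x]
    by (simp add: energy_def less_eq_ennreal.rep_eq ereal_minus_mono sum_divide_distrib)
  also have "\<dots> = ereal (- g)"
    using assms(4) unfolding config_value_def by (cases "enn2ereal (coulomb_cost k x)") auto
  finally show ?thesis .
qed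

section \<open>Identification of the least mass of a minimizer\<close>

lemma ionization_eq:
  fixes V :: "real ^ 'd \<Rightarrow> real"
  assumes "0 < N" and "V \<in> C0"
  shows "ionization N V = real (critical_index N V) / real N"
proof -
  define \<phi> where "\<phi> = (\<lambda>x. V x / real N)"
  define k where "k = critical_index N V"
  note crit = critical_index[OF assms, folded \<phi>_def k_def]
  have \<phi>: "\<phi> \<in> C0"
    unfolding \<phi>_def by (intro C0_divide assms)
  obtain g where g: "best_value \<phi> N = ereal g"
    using best_value_finite[OF \<phi>] by blast
  \<comment> \<open>\<open>best_value\<close> agrees at \<open>k\<close> and \<open>N\<close>, so an
    optimal configuration of only \<open>k\<close> particles already attains
    \<open>g\<close>.\<close>
  obtain x where x: "config_value \<phi> k x = ereal g"
    using best_value_attained[OF \<phi> crit(3)] crit(2) g by metis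
  let ?\<rho> = "partial_empirical N k x"
  have le: "energy N V ?\<rho> \<le> ereal (- g)"
    using energy_partial_empirical_le[OF assms(1) crit(1) assms(2)] x by (simp add: \<phi>_def)
  have "?\<rho> \<in> subprob_measures"
    using crit(1) assms(1)
    by (simp add: subprob_measures_def emeasure_partial_empirical)
  \<comment> \<open>Its energy is at most \<open>- g\<close>, the lower bound valid on all of
    \<open>subprob_measures\<close>.\<close>
  then have min: "?\<rho> \<in> minimizers N V"
    using le energy_ge[OF assms _ g[unfolded \<phi>_def]] by (auto simp: minimizers_def intro: order_trans)
  have mass: "measure ?\<rho> UNIV = real k / real N"
    by (simp add: measure_def emeasure_partial_empirical)
  show ?thesis
    unfolding ionization_def k_def[symmetric]
  proof (rule Least_equality)
    show "real k / real N \<in> (\<lambda>\<rho>. measure \<rho> UNIV) ` minimizers N V"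
      using min mass by force
    fix m assume "m \<in> (\<lambda>\<rho>. measure \<rho> UNIV) ` minimizers N V"
    then obtain \<rho> where m: "m = measure \<rho> UNIV" and \<rho>: "\<rho> \<in> minimizers N V"
      by auto
    \<comment> \<open>For \<open>k = 0\<close> nonnegativity of mass suffices; for positive
      \<open>k\<close> the strict increase at \<open>k\<close> supplies the gap below
      \<open>g\<close>.\<close>
    show "real k / real N \<le> m"
    proof (cases "k = 0")
      case True
      then show ?thesis by (simp add: m)
    next
      case False
      have "energy N V \<rho> \<le> energy N V ?\<rho>"
        using \<rho> \<open>?\<rho> \<in> subprob_measures\<close> by (auto simp: minimizers_def)
      with le have "energy N V \<rho> \<le> ereal (- g)" by (rule order_trans[rotated])
      then show ?thesis
        unfolding m using \<rho> False crit g assms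
        by (intro measure_ge_if_energy_le[of N V \<rho> k g]) (auto simp: minimizers_def \<phi>_def)
    qed
  qed
qed

theorem theorem5p6:
  fixes N :: nat
  assumes "N \<ge> 1"
  shows "(\<forall>V \<in> (C0 :: (real ^ 'd \<Rightarrow> real) set).
            ionization N V = real (critical_index N V) / real N) \<and>
         ionization N ` (C0 :: (real ^ 'd \<Rightarrow> real) set) \<subseteq> {real k / real N | k. k \<le> N}"
proof (intro conjI ballI image_subsetI)
  fix V :: "real ^ 'd \<Rightarrow> real" assume V: "V \<in> C0"
  then show eq: "ionization N V = real (critical_index N V) / real N"
    using assms by (intro ionization_eq) auto
  show "ionization N V \<in> {real k / real N | k. k \<le> N}"
    unfolding eq using critical_index(1)[of N V] V assms by auto
qed

end
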